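(* Let $\rho=r/s$, where $s$ is a power of $2$, $r$ is an odd integer, and $0<r<s$. Then for every positive integer $e$ there exists a Boolean function $f$ on the vertices of $H(n,2)$, where $n=(2s-1)2^{e-1}-s$, such that $f$ depends essentially on all of its $n$ arguments, $f$ has degree $es/2$, and the density of ones of $f$ (the proportion of vertices on which $f$ takes the value $1$) equals $\rho$.
   Context: $H(n,2)$ is the graph on the set $\Sigma^n$ of words of length $n$ over an alphabet $\Sigma$ of size $2$, two words being adjacent if and only if they differ in exactly one position. A Boolean function is a $\{0,1\}$-valued function on the vertices of $H(n,2)$. A function $f$ on the vertices of $H(n,2)$ depends essentially on its $i$th argument if there are two vertices $\bar x,\bar y$ differing in only the $i$th position such that $f(\bar x)\ne f(\bar y)$. Degree: the adjacency eigenvalues of $H(n,2)$ are $\lambda_i=n-2i$, $0\le i\le n$. Let $U_i$ be the $\lambda_i$-eigenspace, i.e., the space of functions $f:\Sigma^n\to\mathbb{R}$ satisfying $\lambda_i f(x)=\sum_{y\in N(x)}f(y)$ for every vertex $x$, where $N(x)$ is the set of neighbors of $x$. Every real-valued function $f$ on the vertices is uniquely a sum of its projections onto $U_0,\ldots,U_n$; the degree of $f$ is the maximum $i$ for which the projection onto $U_i$ is nonzero (the degree of the zero function is $0$). Equivalently, identifying $\Sigma$ with any two distinct real numbers (e.g. $\{0,1\}$ or $\{1,-1\}$), it is the minimum degree of a real polynomial in $n$ variables representing $f$. *)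

theory Defs
  imports Complex_Main
begin

definition words :: "'a set \<Rightarrow> nat \<Rightarrow> 'a list set" where
  "words A n = {x. set x \<subseteq> A \<and> length x = n}"

definition hamming_nbrs :: "'a set \<Rightarrow> nat \<Rightarrow> 'a list \<Rightarrow> 'a list set" where
  "hamming_nbrs A n x = {y \<in> words A n. card {i. i < n \<and> x ! i \<noteq> y ! i} = 1}"

definition boolean_fun :: "'a set \<Rightarrow> nat \<Rightarrow> ('a list \<Rightarrow> real) \<Rightarrow> bool" where
  "boolean_fun A n f \<longleftrightarrow> (\<forall>x\<in>words A n. f x \<in> {0, 1})"

definition depends_on :: "'a set \<Rightarrow> nat \<Rightarrow> ('a list \<Rightarrow> real) \<Rightarrow> nat \<Rightarrow> bool" where
  "depends_on A n f i \<longleftrightarrow>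
     (\<exists>x\<in>words A n. \<exists>y\<in>words A n. {j. j < n \<and> x ! j \<noteq> y ! j} = {i} \<and> f x \<noteq> f y)"

definition density_of_ones :: "'a set \<Rightarrow> nat \<Rightarrow> ('a list \<Rightarrow> real) \<Rightarrow> real" where
  "density_of_ones A n f = real (card {x \<in> words A n. f x = 1}) / real (card (words A n))"

(* A function on the vertices is represented by its extension by 0 to all lists, so that
   equality of functions on the vertices is equality in HOL. *)
definition eigenspace :: "'a set \<Rightarrow> nat \<Rightarrow> nat \<Rightarrow> ('a list \<Rightarrow> real) set" where
  "eigenspace A n i =
     {f. (\<forall>x. x \<notin> words A n \<longrightarrow> f x = 0) \<and>
         (\<forall>x\<in>words A n. (real n - 2 * real i) * f x = (\<Sum>y\<in>hamming_nbrs A n x. f y))}"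

definition eigendecomposition ::
    "'a set \<Rightarrow> nat \<Rightarrow> ('a list \<Rightarrow> real) \<Rightarrow> (nat \<Rightarrow> 'a list \<Rightarrow> real) \<Rightarrow> bool" where
  "eigendecomposition A n f g \<longleftrightarrow>
     (\<forall>i\<le>n. g i \<in> eigenspace A n i) \<and> (\<forall>i>n. g i = (\<lambda>_. 0)) \<and>
     (\<forall>x\<in>words A n. f x = (\<Sum>i\<le>n. g i x))"

(* Well defined when card A = 2, by eigendecomposition_ex1 below. *)
definition eigenprojection :: "'a set \<Rightarrow> nat \<Rightarrow> nat \<Rightarrow> ('a list \<Rightarrow> real) \<Rightarrow> 'a list \<Rightarrow> real" where
  "eigenprojection A n i f = (THE g. eigendecomposition A n f g) i"

definition fun_degree :: "'a set \<Rightarrow> nat \<Rightarrow> ('a list \<Rightarrow> real) \<Rightarrow> nat" where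
  "fun_degree A n f = Max (insert 0 {i. i \<le> n \<and> eigenprojection A n i f \<noteq> (\<lambda>_. 0)})"

lemma finite_words: "finite A \<Longrightarrow> finite (words A n)"
  unfolding words_def by (rule finite_lists_length_eq)

lemma words_nth: "x \<in> words A n \<Longrightarrow> i < n \<Longrightarrow> x ! i \<in> A"
  unfolding words_def using nth_mem by blast

lemma eigenspace_orthogonal:
  assumes A: "finite A" and u: "u \<in> eigenspace A n i" and v: "v \<in> eigenspace A n j"
    and ij: "i \<noteq> j"
  shows "(\<Sum>x\<in>words A n. u x * v x) = 0"
proof -
  have nb: "(\<Sum>y\<in>hamming_nbrs A n x. h y) =
      (\<Sum>y\<in>words A n. if y \<in> hamming_nbrs A n x then h y else 0)" for x and h :: "_ \<Rightarrow> real"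
  proof -
    have "words A n \<inter> hamming_nbrs A n x = hamming_nbrs A n x"
      by (auto simp: hamming_nbrs_def)
    then show ?thesis
      using sum.inter_restrict[OF finite_words[OF A], of h n "hamming_nbrs A n x"] by simp
  qed
  have "(real n - 2 * real i) * (\<Sum>x\<in>words A n. u x * v x) =
      (\<Sum>x\<in>words A n. \<Sum>y\<in>hamming_nbrs A n x. u y * v x)"
    using u by (auto simp: eigenspace_def sum_distrib_left sum_distrib_right
        mult.assoc[symmetric] intro!: sum.cong)
  also have "\<dots> = (\<Sum>x\<in>words A n. \<Sum>y\<in>words A n.
      if y \<in> hamming_nbrs A n x then u y * v x else 0)"
    by (simp add: nb)
  also have "\<dots> = (\<Sum>y\<in>words A n. \<Sum>x\<in>words A n.
      if y \<in> hamming_nbrs A n x then u y * v x else 0)"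
    by (rule sum.swap)
  also have "\<dots> = (\<Sum>y\<in>words A n. \<Sum>x\<in>words A n.
      if x \<in> hamming_nbrs A n y then u y * v x else 0)"
    by (intro sum.cong refl if_cong) (auto simp: hamming_nbrs_def eq_commute)
  also have "\<dots> = (\<Sum>y\<in>words A n. \<Sum>x\<in>hamming_nbrs A n y. u y * v x)"
    by (simp add: nb)
  also have "\<dots> = (real n - 2 * real j) * (\<Sum>x\<in>words A n. u x * v x)"
  proof -
    have "(\<Sum>x\<in>hamming_nbrs A n y. u y * v x) = (real n - 2 * real j) * (u y * v y)"
      if "y \<in> words A n" for y
    proof -
      have "(\<Sum>x\<in>hamming_nbrs A n y. v x) = (real n - 2 * real j) * v y"
        using v that by (simp add: eigenspace_def)
      then show ?thesis by (simp add: sum_distrib_left[symmetric] mult.left_commute)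
    qed
    then show ?thesis by (simp add: sum_distrib_left)
  qed
  finally show ?thesis using ij by simp
qed

lemma eigendecomposition_unique:
  assumes A: "finite A" and g: "eigendecomposition A n f g" and h: "eigendecomposition A n f h"
  shows "g = h"
proof
  fix i
  define d where "d j = (\<lambda>x. g j x - h j x)" for j
  have d: "d j \<in> eigenspace A n j" if "j \<le> n" for j
    using g h that unfolding eigendecomposition_def eigenspace_def d_def
    by (auto simp: sum_subtractf algebra_simps)
  have s: "(\<Sum>j\<le>n. d j x) = 0" if "x \<in> words A n" for x
    using g h that unfolding eigendecomposition_def d_def by (auto simp: sum_subtractf)
  show "g i = h i"
  proof (cases "i \<le> n")
    case True
    have "0 = (\<Sum>x\<in>words A n. d i x * (\<Sum>j\<le>n. d j x))"
      by (simp add: s)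
    also have "\<dots> = (\<Sum>j\<le>n. \<Sum>x\<in>words A n. d i x * d j x)"
      unfolding sum_distrib_left by (rule sum.swap)
    also have "\<dots> = (\<Sum>j\<le>n. if j = i then \<Sum>x\<in>words A n. d i x * d i x else 0)"
      using eigenspace_orthogonal[OF A d[OF True] d] by (intro sum.cong refl) auto
    also have "\<dots> = (\<Sum>x\<in>words A n. d i x * d i x)"
      using True by simp
    finally have "\<forall>x\<in>words A n. d i x * d i x = 0"
      by (subst (asm) eq_commute, subst (asm) sum_nonneg_eq_0_iff) (auto simp: finite_words[OF A])
    moreover have "d i x = 0" if "x \<notin> words A n" for x
      using d[OF True] that by (auto simp: eigenspace_def)
    ultimately have "d i x = 0" for x by auto
    then show ?thesis by (auto simp: d_def)
  next
    case False
    then show ?thesis using g h by (simp add: eigendecomposition_def)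
  qed
qed

definition wsign :: "'a \<Rightarrow> 'a \<Rightarrow> real" where
  "wsign a c = (if c = a then 1 else -1)"

definition wchar :: "'a \<Rightarrow> nat set \<Rightarrow> 'a list \<Rightarrow> real" where
  "wchar a S x = (\<Prod>i\<in>S. wsign a (x ! i))"

definition flip :: "'a \<Rightarrow> 'a \<Rightarrow> 'a \<Rightarrow> 'a" where
  "flip a b c = (if c = a then b else a)"

lemma hamming_nbrs_flip:
  assumes ab: "a \<noteq> b" and x: "x \<in> words {a, b} n"
  shows "bij_betw (\<lambda>i. x[i := flip a b (x ! i)]) {..<n} (hamming_nbrs {a, b} n x)"
proof -
  have len: "length x = n" using x by (simp add: words_def)
  have mem: "i < n \<Longrightarrow> x ! i = a \<or> x ! i = b" for i
    using words_nth[OF x] by blast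
  have fl: "flip a b (x ! i) \<noteq> x ! i" for i
    using ab by (auto simp: flip_def)
  have diff: "{j. j < n \<and> x ! j \<noteq> x[i := flip a b (x ! i)] ! j} = {i}" if "i < n" for i
    using that fl[of i] len by (auto simp: nth_list_update)
  show ?thesis
  proof (rule bij_betw_imageI)
    show "inj_on (\<lambda>i. x[i := flip a b (x ! i)]) {..<n}"
    proof (rule inj_onI)
      fix i j
      assume ij: "i \<in> {..<n}" "j \<in> {..<n}"
        and eq: "x[i := flip a b (x ! i)] = x[j := flip a b (x ! j)]"
      have "{i} = {k. k < n \<and> x ! k \<noteq> x[i := flip a b (x ! i)] ! k}"
        using diff[of i] ij by simp
      also have "\<dots> = {k. k < n \<and> x ! k \<noteq> x[j := flip a b (x ! j)] ! k}"
        by (simp only: eq)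
      also have "\<dots> = {j}" using diff[of j] ij by simp
      finally show "i = j" by simp
    qed
    show "(\<lambda>i. x[i := flip a b (x ! i)]) ` {..<n} = hamming_nbrs {a, b} n x"
    proof (intro equalityI subsetI)
      fix y assume "y \<in> (\<lambda>i. x[i := flip a b (x ! i)]) ` {..<n}"
      then obtain i where i: "i < n" "y = x[i := flip a b (x ! i)]" by auto
      have "set y \<subseteq> insert (flip a b (x ! i)) (set x)"
        unfolding i by (rule set_update_subset_insert)
      then have "y \<in> words {a, b} n"
        using x i by (auto simp: words_def flip_def split: if_splits)
      then show "y \<in> hamming_nbrs {a, b} n x"
        using diff[OF i(1)] i(2) by (simp add: hamming_nbrs_def)
    next
      fix y assume y: "y \<in> hamming_nbrs {a, b} n x"
      then obtain i where i: "{j. j < n \<and> x ! j \<noteq> y ! j} = {i}"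
        by (auto simp: hamming_nbrs_def card_1_singleton_iff)
      have yw: "y \<in> words {a, b} n" using y by (simp add: hamming_nbrs_def)
      then have yl: "length y = n" by (simp add: words_def)
      have ym: "j < n \<Longrightarrow> y ! j = a \<or> y ! j = b" for j
        using words_nth[OF yw] by blast
      have i': "i < n" "x ! i \<noteq> y ! i" using i by auto
      have "y = x[i := flip a b (x ! i)]"
      proof (rule nth_equalityI)
        fix j assume j: "j < length y"
        show "y ! j = x[i := flip a b (x ! i)] ! j"
        proof (cases "j = i")
          case True
          then show ?thesis using i' len mem[of i] ym[of i] ab by (auto simp: flip_def)
        next
          case False
          then have "x ! j = y ! j" using i j yl by blast
          then show ?thesis using False by simp
        qed
      qed (simp add: len yl)
      then show "y \<in> (\<lambda>i. x[i := flip a b (x ! i)]) ` {..<n}" using i' by auto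
    qed
  qed
qed

lemma wchar_nbrs:
  assumes ab: "a \<noteq> b" and x: "x \<in> words {a, b} n" and S: "S \<subseteq> {..<n}"
  shows "(\<Sum>y\<in>hamming_nbrs {a, b} n x. wchar a S y) = (real n - 2 * real (card S)) * wchar a S x"
proof -
  have fS: "finite S" using S finite_subset by blast
  have len: "length x = n" using x by (simp add: words_def)
  have eq: "wchar a S (x[i := flip a b (x ! i)]) = (if i \<in> S then -1 else 1) * wchar a S x"
    if "i < n" for i
  proof (cases "i \<in> S")
    case True
    have "wchar a S (x[i := flip a b (x ! i)]) =
        wsign a (flip a b (x ! i)) * (\<Prod>j\<in>S - {i}. wsign a (x ! j))"
      unfolding wchar_def using that len
      by (subst prod.remove[OF fS True]) (auto intro!: prod.cong)
    also have "\<dots> = - (wsign a (x ! i) * (\<Prod>j\<in>S - {i}. wsign a (x ! j)))"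
      using ab by (auto simp: wsign_def flip_def)
    also have "\<dots> = - wchar a S x"
      unfolding wchar_def by (subst prod.remove[OF fS True]) simp
    finally show ?thesis using True by simp
  next
    case False
    then have "x[i := flip a b (x ! i)] ! j = x ! j" if "j \<in> S" for j
      using that by (metis nth_list_update_neq)
    then have "wchar a S (x[i := flip a b (x ! i)]) = wchar a S x"
      unfolding wchar_def by (intro prod.cong refl) simp
    then show ?thesis using False by simp
  qed
  have "(\<Sum>y\<in>hamming_nbrs {a, b} n x. wchar a S y) =
      (\<Sum>i<n. wchar a S (x[i := flip a b (x ! i)]))"
    using sum.reindex_bij_betw[OF hamming_nbrs_flip[OF ab x]] by metis
  also have "\<dots> = (\<Sum>i<n. (if i \<in> S then -1 else 1)) * wchar a S x"
    by (simp add: eq sum_distrib_right)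
  also have "(\<Sum>i<n. (if i \<in> S then -1 else 1 :: real)) =
      (\<Sum>i<n. 1 - 2 * (if i \<in> S then 1 else 0))"
    by (intro sum.cong) auto
  also have "\<dots> = real n - 2 * real (card S)"
    using S by (simp add: sum_subtractf sum_distrib_left[symmetric] sum.If_cases Int_absorb1)
  finally show ?thesis .
qed

lemma wchar_expansion:
  assumes ab: "a \<noteq> b" and x: "x \<in> words {a, b} n"
  shows "f x = (\<Sum>S\<in>Pow {..<n}. (\<Sum>y\<in>words {a, b} n. f y * wchar a S y) / 2 ^ n * wchar a S x)"
proof -
  have delta: "(\<Sum>S\<in>Pow {..<n}. wchar a S y * wchar a S x) = (if y = x then 2 ^ n else 0)"
    if y: "y \<in> words {a, b} n" for y
  proof -
    have "(\<Sum>S\<in>Pow {..<n}. wchar a S y * wchar a S x) =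
        (\<Prod>i<n. wsign a (y ! i) * wsign a (x ! i) + 1)"
      by (subst prod_add) (auto simp: wchar_def prod.distrib)
    also have "\<dots> = (if y = x then 2 ^ n else 0)"
    proof (cases "y = x")
      case True
      then show ?thesis by (simp add: wsign_def if_distrib cong: if_cong)
    next
      case False
      then obtain i where i: "i < n" "y ! i \<noteq> x ! i"
        using x y by (auto simp: words_def list_eq_iff_nth_eq)
      moreover have "x ! i \<in> {a, b}" "y ! i \<in> {a, b}"
        using words_nth[OF x] words_nth[OF y] i by blast+
      ultimately have "wsign a (y ! i) * wsign a (x ! i) + 1 = 0"
        using ab by (auto simp: wsign_def)
      then show ?thesis using i False by (auto intro!: prod_zero)
    qed
    finally show ?thesis .
  qed
  have "(\<Sum>S\<in>Pow {..<n}. (\<Sum>y\<in>words {a, b} n. f y * wchar a S y) / 2 ^ n * wchar a S x) =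
      (\<Sum>S\<in>Pow {..<n}. \<Sum>y\<in>words {a, b} n. f y / 2 ^ n * (wchar a S y * wchar a S x))"
    by (simp add: sum_divide_distrib sum_distrib_right mult.assoc)
  also have "\<dots> = (\<Sum>y\<in>words {a, b} n. f y / 2 ^ n * (\<Sum>S\<in>Pow {..<n}. wchar a S y * wchar a S x))"
    by (subst sum.swap) (simp only: sum_distrib_left)
  also have "\<dots> = (\<Sum>y\<in>words {a, b} n. if y = x then f y else 0)"
    by (intro sum.cong refl) (simp add: delta)
  also have "\<dots> = f x"
    using x by (simp add: finite_words)
  finally show ?thesis by simp
qed

lemma eigendecomposition_exists:
  assumes ab: "a \<noteq> b"
  shows "\<exists>g. eigendecomposition {a, b} n f g"
proof -
  define c where "c S = (\<Sum>y\<in>words {a, b} n. f y * wchar a S y) / 2 ^ n" for S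
  define L where "L i = {S \<in> Pow {..<n}. card S = i}" for i
  define g where "g i = (\<lambda>x. if x \<in> words {a, b} n then \<Sum>S\<in>L i. c S * wchar a S x else 0)" for i
  have le: "card S \<le> n" if "S \<in> Pow {..<n}" for S
    using card_mono[of "{..<n}" S] that by auto
  have "g i \<in> eigenspace {a, b} n i" for i
  proof -
    have "(real n - 2 * real i) * g i x = (\<Sum>y\<in>hamming_nbrs {a, b} n x. g i y)"
      if x: "x \<in> words {a, b} n" for x
    proof -
      have "(\<Sum>y\<in>hamming_nbrs {a, b} n x. g i y) =
          (\<Sum>y\<in>hamming_nbrs {a, b} n x. \<Sum>S\<in>L i. c S * wchar a S y)"
        by (intro sum.cong refl) (simp add: g_def hamming_nbrs_def)
      also have "\<dots> = (\<Sum>S\<in>L i. c S * (\<Sum>y\<in>hamming_nbrs {a, b} n x. wchar a S y))"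
        by (subst sum.swap) (simp only: sum_distrib_left)
      also have "\<dots> = (\<Sum>S\<in>L i. c S * ((real n - 2 * real i) * wchar a S x))"
        by (intro sum.cong refl) (auto simp: L_def wchar_nbrs[OF ab x])
      also have "\<dots> = (real n - 2 * real i) * g i x"
        using x by (simp add: g_def sum_distrib_left mult.left_commute)
      finally show ?thesis by simp
    qed
    then show ?thesis by (auto simp: eigenspace_def g_def)
  qed
  moreover have "g i = (\<lambda>_. 0)" if "i > n" for i
  proof -
    have "L i = {}" unfolding L_def using le that by (metis (mono_tags, lifting) Collect_empty_eq leD)
    then show ?thesis by (auto simp: g_def)
  qed
  moreover have "f x = (\<Sum>i\<le>n. g i x)" if x: "x \<in> words {a, b} n" for x
  proof -
    have "f x = (\<Sum>S\<in>Pow {..<n}. c S * wchar a S x)"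
      unfolding c_def by (rule wchar_expansion[OF ab x])
    also have "\<dots> = (\<Sum>i\<le>n. \<Sum>S\<in>L i. c S * wchar a S x)"
      unfolding L_def by (rule sum.group[symmetric]) (use le in auto)
    finally show ?thesis using x by (simp add: g_def)
  qed
  ultimately show ?thesis unfolding eigendecomposition_def by blast
qed

lemma eigendecomposition_ex1:
  assumes "card A = 2"
  shows "\<exists>!g. eigendecomposition A n f g"
proof -
  obtain a b where "A = {a, b}" "a \<noteq> b"
    using assms by (auto simp: card_2_iff)
  then show ?thesis
    using eigendecomposition_exists[of a b n f] eigendecomposition_unique[of A n f] by auto
qed

end

theory Submission
  imports Defs
begin

text \<open>
  Colour the vertices with \<open>s = 2 ^ k\<close> colours so that every vertex has exactly \<open>e\<close> neighbours of
  every colour other than its own. If \<open>f\<close> is the indicator of a union of \<open>r\<close> colours, then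
  \<open>f - r / s\<close> is an eigenfunction for \<open>n - e s\<close>, so \<open>f\<close> has degree \<open>e s / 2\<close>; it is
  orthogonal to the constants, so \<open>f\<close> has density \<open>r / s\<close>.

  For \<open>e = 1\<close> the colour is the Hamming syndrome of a word of length \<open>s - 1\<close>. Given such a
  colouring \<open>G\<close> in dimension \<open>n\<close>, colour \<open>z @ u @ v\<close> with \<open>z\<close> of length \<open>s\<close> and \<open>u\<close>, \<open>v\<close> of
  length \<open>n\<close> by the sum of the syndrome of \<open>z\<close> and of \<open>G u\<close> or \<open>G v\<close>, depending on the parity
  of \<open>z\<close>: a change in \<open>z\<close> reaches every colour once, a change in the selected block reaches
  every other colour \<open>e\<close> times, and a change in the remaining block keeps the colour.
  Colours are added by bitwise exclusive or; since \<open>r\<close> is odd, no non-zero translation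
  preserves a set of \<open>r\<close> colours, which makes all arguments essential.
\<close>

section \<open>Exclusive or on the numbers below a power of two\<close>

lemma xor_nat_less_exp: "xor m n < 2 ^ k" if "m < 2 ^ k" "n < 2 ^ k" for m n k :: nat
  using that by (metis take_bit_nat_eq_self_iff take_bit_xor)

lemma xor_xor_cancel: "xor v (xor v c) = c" for v c :: nat
  by (simp flip: xor.assoc)

lemma sum_xor_shift:
  assumes "v < 2 ^ k"
  shows "(\<Sum>c<2 ^ k. g (xor v c)) = (\<Sum>c<2 ^ k. g (c :: nat))"
  by (rule sum.reindex_bij_witness[where i = "xor v" and j = "xor v"])
    (use assms in \<open>auto simp: xor_xor_cancel intro: xor_nat_less_exp\<close>)

text \<open>The orbits of \<open>g\<close> in \<open>S\<close> are pairs; the linear order selects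
  one element of each, which splits \<open>S\<close> into two halves exchanged by
  \<open>g\<close>.\<close>

lemma even_card_involution:
  fixes g :: "'b :: linorder \<Rightarrow> 'b"
  assumes "finite S" and g: "\<And>x. x \<in> S \<Longrightarrow> g x \<in> S \<and> g (g x) = x \<and> g x \<noteq> x"
  shows "even (card S)"
proof -
  let ?L = "{x \<in> S. x < g x}" and ?R = "{x \<in> S. g x < x}"
  have "bij_betw g ?L ?R"
    by (rule bij_betw_byWitness[where f' = g]) (use g in auto)
  then have "card ?L = card ?R"
    by (rule bij_betw_same_card)
  moreover have "S = ?L \<union> ?R"
    using g by (auto simp: neq_iff)
  then have "card S = card (?L \<union> ?R)"
    by simp
  then have "card S = card ?L + card ?R"
    using assms(1) by (subst (asm) card_Un_disjoint) auto
  ultimately show ?thesis by simp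
qed

text \<open>Translation by a non-zero \<open>h\<close> is an involution without fixed points, so it
  cannot preserve a set of odd size.\<close>

lemma xor_moves_odd_interval:
  fixes h t :: nat
  assumes "odd t" "h \<noteq> 0"
  obtains c where "c < t" "\<not> xor h c < t"
proof -
  have "\<not> (\<forall>c<t. xor h c < t)"
  proof
    assume *: "\<forall>c<t. xor h c < t"
    have "xor h c \<noteq> c" for c
      using assms(2) by (metis xor.assoc xor.right_neutral xor_self_eq)
    then have "even (card {..<t})"
      using * by (intro even_card_involution[where g = "xor h"]) (auto simp: xor_xor_cancel)
    then show False
      using assms(1) by simp
  qed
  then show ?thesis
    using that by blast
qed

section \<open>Neighbours\<close>

lemma sum_lessThan_add:
  "(\<Sum>i<m + n. g i) = (\<Sum>i<m. g i) + (\<Sum>i<n. g (m + i :: nat))"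
  by (induction n) (simp_all add: add.assoc)

text \<open>Neighbours are indexed by the flipped position, so that sums over them split along
  concatenations of words.\<close>

definition nbr :: "'a \<Rightarrow> 'a \<Rightarrow> 'a list \<Rightarrow> nat \<Rightarrow> 'a list" where
  "nbr a b x i = x[i := flip a b (x ! i)]"

lemma nbr_append_left: "i < length x \<Longrightarrow> nbr a b (x @ y) i = nbr a b x i @ y"
  by (simp add: nbr_def nth_append list_update_append)

lemma nbr_append_right: "nbr a b (x @ y) (length x + j) = x @ nbr a b y j"
  by (simp add: nbr_def list_update_append)

lemma nbr_in_words:
  "nbr a b x i \<in> words {a, b} n" if "a \<noteq> b" "x \<in> words {a, b} n" "i < n"
  using hamming_nbrs_flip[OF that(1,2)] that(3)
  by (auto simp: bij_betw_def nbr_def hamming_nbrs_def)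

lemma nbr_differs:
  "{j. j < n \<and> x ! j \<noteq> nbr a b x i ! j} = {i}" if "a \<noteq> b" "x \<in> words {a, b} n" "i < n"
  using that by (auto simp: nbr_def words_def flip_def nth_list_update split: if_splits)

lemma sum_hamming_nbrs:
  "(\<Sum>y\<in>hamming_nbrs {a, b} n x. g y) = (\<Sum>i<n. g (nbr a b x i))"
  if "a \<noteq> b" "x \<in> words {a, b} n"
  using sum.reindex_bij_betw[OF hamming_nbrs_flip[OF that], of g] by (simp add: nbr_def)

lemma words_append: "x \<in> words A m \<Longrightarrow> y \<in> words A n \<Longrightarrow> x @ y \<in> words A (m + n)"
  by (auto simp: words_def)

lemma words_appendE:
  assumes "x \<in> words A (m + n)"
  obtains y z where "x = y @ z" "y \<in> words A m" "z \<in> words A n"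
proof -
  have "set (take m x) \<subseteq> A" "set (drop m x) \<subseteq> A"
    using assms set_take_subset[of m x] set_drop_subset[of m x] by (auto simp: words_def)
  then show ?thesis
    using assms by (intro that[of "take m x" "drop m x"]) (auto simp: words_def)
qed

lemma replicate_in_words: "a \<in> A \<Longrightarrow> replicate n a \<in> words A n"
  by (auto simp: words_def)

section \<open>Syndrome and parity\<close>

text \<open>The columns of the parity check matrix are \<open>m, m + 1, m + 2, \<dots>\<close> in binary.\<close>

primrec syndrome :: "'a \<Rightarrow> nat \<Rightarrow> 'a list \<Rightarrow> nat" where
  "syndrome b m [] = 0"
| "syndrome b m (c # x) = xor (if c = b then m else 0) (syndrome b (Suc m) x)"

lemma syndrome_less: "m + length x \<le> 2 ^ k \<Longrightarrow> syndrome b m x < 2 ^ k"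
  by (induction x arbitrary: m) (auto intro!: xor_nat_less_exp)

lemma syndrome_replicate: "a \<noteq> b \<Longrightarrow> syndrome b m (replicate n a) = 0"
  by (induction n arbitrary: m) auto

text \<open>Flipping position \<open>i\<close> adds or removes the column \<open>m + i\<close>; both
  amount to exclusive or with it.\<close>

lemma syndrome_nbr:
  assumes "a \<noteq> b" "set x \<subseteq> {a, b}" "i < length x"
  shows "syndrome b m (nbr a b x i) = xor (m + i) (syndrome b m x)"
  using assms
proof (induction x arbitrary: m i)
  case (Cons c x)
  show ?case
  proof (cases i)
    case 0
    then show ?thesis
      using Cons.prems by (auto simp: nbr_def flip_def xor_xor_cancel)
  next
    case (Suc j)
    have "syndrome b (Suc m) (nbr a b x j) = xor (Suc m + j) (syndrome b (Suc m) x)"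
      using Cons.prems Suc by (intro Cons.IH) auto
    then show ?thesis
      using Suc by (simp add: nbr_def xor.left_commute)
  qed
qed simp

lemma even_count_nbr:
  assumes "a \<noteq> b" "set x \<subseteq> {a, b}" "i < length x"
  shows "even (count_list (nbr a b x i) b) \<longleftrightarrow> odd (count_list x b)"
  using assms
proof (induction x arbitrary: i)
  case (Cons c x)
  show ?case
  proof (cases i)
    case 0
    then show ?thesis
      using Cons.prems by (auto simp: nbr_def flip_def)
  next
    case (Suc j)
    have "even (count_list (nbr a b x j) b) \<longleftrightarrow> odd (count_list x b)"
      using Cons.prems Suc by (intro Cons.IH) auto
    then show ?thesis
      using Suc by (simp add: nbr_def)
  qed
qed simp

section \<open>The colouring\<close>

text \<open>Tested on the indicator of a colour other than \<open>G x\<close>, the third condition says that \<open>x\<close>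
  has exactly \<open>e\<close> neighbours of that colour.\<close>

definition equitable :: "'a \<Rightarrow> 'a \<Rightarrow> nat \<Rightarrow> nat \<Rightarrow> nat \<Rightarrow> ('a list \<Rightarrow> nat) \<Rightarrow> bool" where
  "equitable a b k n e G \<longleftrightarrow>
     (\<forall>x\<in>words {a, b} n. G x < 2 ^ k) \<and>
     (\<forall>c<2 ^ k. \<exists>x\<in>words {a, b} n. G x = c) \<and>
     (\<forall>g :: nat \<Rightarrow> real. \<forall>x\<in>words {a, b} n.
        (\<Sum>i<n. g (G (nbr a b x i))) = (real n - real e * 2 ^ k) * g (G x) + real e * (\<Sum>c<2 ^ k. g c)) \<and>
     (\<forall>i<n. \<exists>h. h \<noteq> 0 \<and>
        (\<forall>c<2 ^ k. \<exists>x\<in>words {a, b} n. G x = c \<and> G (nbr a b x i) = xor h c))"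

text \<open>The columns \<open>1, ..., 2 ^ k - 1\<close> are the non-zero colours, each once, so the
  flips lead from any colour to every other colour exactly once.\<close>

lemma equitable_syndrome:
  assumes ab: "a \<noteq> b"
  shows "equitable a b k (2 ^ k - 1) 1 (syndrome b 1)"
proof -
  let ?n = "2 ^ k - 1 :: nat" and ?G = "syndrome b 1"
  have pow: "2 ^ k = Suc ?n" by simp
  have less: "?G x < 2 ^ k" if "x \<in> words {a, b} ?n" for x
    using that by (intro syndrome_less) (auto simp: words_def)
  have shift: "?G (nbr a b x i) = xor (Suc i) (?G x)" if "x \<in> words {a, b} ?n" "i < ?n" for x i
    using syndrome_nbr[of a b x i 1] that ab by (simp add: words_def)
  have onto: "\<exists>x\<in>words {a, b} ?n. ?G x = c" if c: "c < 2 ^ k" for c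
  proof (cases c)
    case 0
    then show ?thesis
      using ab by (intro bexI[of _ "replicate ?n a"]) (auto simp: syndrome_replicate replicate_in_words)
  next
    case (Suc j)
    have r: "replicate ?n a \<in> words {a, b} ?n"
      by (simp add: replicate_in_words)
    have j: "j < ?n"
      using c Suc by simp
    have "?G (nbr a b (replicate ?n a) j) = c"
      using shift[OF r j] ab Suc by (simp add: syndrome_replicate)
    then show ?thesis
      using nbr_in_words[OF ab r j] by blast
  qed
  have sum: "(\<Sum>i<?n. g (?G (nbr a b x i))) = (real ?n - real 1 * 2 ^ k) * g (?G x) + real 1 * (\<Sum>c<2 ^ k. g c)"
    if x: "x \<in> words {a, b} ?n" for g :: "nat \<Rightarrow> real" and x
  proof -
    \<comment> \<open>After translation by the colour of \<open>x\<close>, the term at 0 is that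
      colour itself and the term at \<open>Suc i\<close> is the colour of the neighbour at position
      \<open>i\<close>.\<close>
    have "(\<Sum>c<2 ^ k. g c) = (\<Sum>c<Suc ?n. g (xor (?G x) c))"
      using sum_xor_shift[OF less[OF x], of g] pow by simp
    also have "\<dots> = g (?G x) + (\<Sum>i<?n. g (xor (?G x) (Suc i)))"
      by (subst sum.lessThan_Suc_shift) simp
    also have "(\<Sum>i<?n. g (xor (?G x) (Suc i))) = (\<Sum>i<?n. g (?G (nbr a b x i)))"
      using x by (intro sum.cong refl) (simp add: shift xor.commute del: One_nat_def)
    finally show ?thesis
      by (simp add: of_nat_diff algebra_simps)
  qed
  have "\<exists>h. h \<noteq> 0 \<and> (\<forall>c<2 ^ k. \<exists>x\<in>words {a, b} ?n. ?G x = c \<and> ?G (nbr a b x i) = xor h c)"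
    if "i < ?n" for i
    by (rule exI[of _ "Suc i"]) (use onto shift that in fastforce)
  then show ?thesis
    unfolding equitable_def using less onto sum by blast
qed

lemma equitable_step:
  assumes ab: "a \<noteq> b" and k: "k > 0" and G: "equitable a b k n e G"
  shows "\<exists>G'. equitable a b k (2 ^ k + (n + n)) (Suc e) G'"
proof -
  let ?s = "2 ^ k :: nat" and ?W = "words {a, b}"
  have less: "G x < 2 ^ k" if "x \<in> ?W n" for x
    using G that by (auto simp: equitable_def)
  have onto: "\<exists>x\<in>?W n. G x = c" if "c < 2 ^ k" for c
    using G that by (auto simp: equitable_def)
  have sum: "(\<Sum>i<n. g (G (nbr a b x i))) = (real n - real e * 2 ^ k) * g (G x) + real e * (\<Sum>c<2 ^ k. g c)"
    if "x \<in> ?W n" for g :: "nat \<Rightarrow> real" and x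
    using G that by (auto simp: equitable_def)
  have dep: "\<exists>h. h \<noteq> 0 \<and> (\<forall>c<2 ^ k. \<exists>x\<in>?W n. G x = c \<and> G (nbr a b x i) = xor h c)"
    if "i < n" for i
    using G that by (auto simp: equitable_def)
  \<comment> \<open>The columns start at 0 here: the flips in the first block then add every colour
    once, including 0, while each of them also switches the selected block.\<close>
  define G' where "G' x = xor (syndrome b 0 (take ?s x))
      (G (if even (count_list (take ?s x) b) then take n (drop ?s x) else drop (?s + n) x))" for x
  have G': "G' (z @ u @ v) = xor (syndrome b 0 z) (G (if even (count_list z b) then u else v))"
    if "z \<in> ?W ?s" "u \<in> ?W n" "v \<in> ?W n" for z u v
    using that by (simp add: G'_def words_def)
  have mem: "z @ u @ v \<in> ?W (?s + (n + n))" if "z \<in> ?W ?s" "u \<in> ?W n" "v \<in> ?W n" for z u v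
    using that by (intro words_append)
  have split: "\<exists>z\<in>?W ?s. \<exists>u\<in>?W n. \<exists>v\<in>?W n. x = z @ u @ v" if "x \<in> ?W (?s + (n + n))" for x
    using that by (metis words_appendE)
  have syn: "syndrome b 0 z < 2 ^ k" if "z \<in> ?W ?s" for z
    using that by (intro syndrome_less) (auto simp: words_def)
  have nbr_z: "G' (nbr a b (z @ u @ v) i) = xor i (xor (syndrome b 0 z) (G (if even (count_list z b) then v else u)))"
    if "z \<in> ?W ?s" "u \<in> ?W n" "v \<in> ?W n" "i < ?s" for z u v i
  proof -
    have z: "set z \<subseteq> {a, b}" "i < length z"
      using that by (auto simp: words_def)
    have "G' (nbr a b (z @ u @ v) i) = G' (nbr a b z i @ u @ v)"
      using z by (simp add: nbr_append_left)
    also have "\<dots> = xor (xor i (syndrome b 0 z)) (G (if even (count_list z b) then v else u))"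
      using that ab z by (subst G') (simp_all add: nbr_in_words even_count_nbr syndrome_nbr)
    finally show ?thesis
      by (simp add: xor.assoc)
  qed
  have nbr_u: "G' (nbr a b (z @ u @ v) (?s + i)) =
      xor (syndrome b 0 z) (G (if even (count_list z b) then nbr a b u i else v))"
    if "z \<in> ?W ?s" "u \<in> ?W n" "v \<in> ?W n" "i < n" for z u v i
  proof -
    have "length z = ?s" "length u = n"
      using that by (auto simp: words_def)
    then have "G' (nbr a b (z @ u @ v) (?s + i)) = G' (z @ nbr a b u i @ v)"
      using nbr_append_right[of a b z "u @ v" i] that by (simp add: nbr_append_left)
    then show ?thesis
      using that by (simp add: G' nbr_in_words[OF ab])
  qed
  have nbr_v: "G' (nbr a b (z @ u @ v) (?s + (n + i))) =
      xor (syndrome b 0 z) (G (if even (count_list z b) then u else nbr a b v i))"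
    if "z \<in> ?W ?s" "u \<in> ?W n" "v \<in> ?W n" "i < n" for z u v i
  proof -
    have "length z = ?s" "length u = n"
      using that by (auto simp: words_def)
    then have "G' (nbr a b (z @ u @ v) (?s + (n + i))) = G' (z @ u @ nbr a b v i)"
      using nbr_append_right[of a b z "u @ v" "n + i"] nbr_append_right[of a b u v i] by simp
    then show ?thesis
      using that by (simp add: G' nbr_in_words[OF ab])
  qed
  \<comment> \<open>\<open>z0\<close> and \<open>z1\<close> both have syndrome 0 but opposite
    parity, because position 0 carries the zero column; they select the first and the second block
    without shifting its colour.\<close>
  define z0 where "z0 = replicate ?s a"
  have z0: "z0 \<in> ?W ?s" "syndrome b 0 z0 = 0" "even (count_list z0 b)"
    using ab by (simp_all add: z0_def replicate_in_words syndrome_replicate count_list_0_iff)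
  define z1 where "z1 = nbr a b z0 0"
  have z1: "z1 \<in> ?W ?s" "syndrome b 0 z1 = 0" "odd (count_list z1 b)"
  proof -
    have z: "set z0 \<subseteq> {a, b}" "0 < length z0"
      using z0(1) by (auto simp: words_def)
    show "z1 \<in> ?W ?s"
      using nbr_in_words[OF ab z0(1)] by (simp add: z1_def)
    show "syndrome b 0 z1 = 0"
      using syndrome_nbr[OF ab z, of 0] z0 by (simp add: z1_def)
    show "odd (count_list z1 b)"
      using even_count_nbr[OF ab z] z0 by (simp add: z1_def)
  qed
  obtain w where w: "w \<in> ?W n"
    using onto[of 0] by auto
  have "G' x < 2 ^ k" if x: "x \<in> ?W (?s + (n + n))" for x
    using split[OF x] by (auto simp: G' intro!: xor_nat_less_exp syn less)
  moreover have "\<exists>x\<in>?W (?s + (n + n)). G' x = c" if c: "c < 2 ^ k" for c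
  proof -
    obtain u where "u \<in> ?W n" "G u = c"
      using onto[OF c] by blast
    then show ?thesis
      using z0 by (intro bexI[of _ "z0 @ u @ u"]) (simp_all add: G' mem)
  qed
  moreover have "(\<Sum>i<?s + (n + n). g (G' (nbr a b x i))) =
      (real (?s + (n + n)) - real (Suc e) * 2 ^ k) * g (G' x) + real (Suc e) * (\<Sum>c<2 ^ k. g c)"
    if x: "x \<in> ?W (?s + (n + n))" for g :: "nat \<Rightarrow> real" and x
  proof -
    obtain z u v where zuv: "z \<in> ?W ?s" "u \<in> ?W n" "v \<in> ?W n" and x: "x = z @ u @ v"
      using split[OF x] by blast
    let ?y = "if even (count_list z b) then u else v"
    let ?y' = "if even (count_list z b) then v else u"
    have y: "?y \<in> ?W n" "?y' \<in> ?W n"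
      using zuv by simp_all
    \<comment> \<open>A flip in \<open>z\<close> selects the other block \<open>?y'\<close>, so the
      new colour is a fixed colour plus \<open>i\<close>, and \<open>i\<close> runs through all
      colours.\<close>
    have "(\<Sum>i<?s. g (G' (nbr a b x i))) = (\<Sum>i<2 ^ k. g (xor (xor (syndrome b 0 z) (G ?y')) i))"
      using zuv by (intro sum.cong refl) (simp add: x nbr_z xor.commute)
    also have "\<dots> = (\<Sum>c<2 ^ k. g c)"
      by (intro sum_xor_shift xor_nat_less_exp syn less zuv y)
    finally have sum_z: "(\<Sum>i<?s. g (G' (nbr a b x i))) = (\<Sum>c<2 ^ k. g c)" .
    \<comment> \<open>The hypothesis on \<open>G\<close> is applied to \<open>g\<close> translated
      by the syndrome of \<open>z\<close>; the translation does not change the sum of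
      \<open>g\<close> over all colours.\<close>
    have "(\<Sum>i<n. g (xor (syndrome b 0 z) (G (nbr a b ?y i)))) =
        (real n - real e * 2 ^ k) * g (xor (syndrome b 0 z) (G ?y))
        + real e * (\<Sum>c<2 ^ k. g (xor (syndrome b 0 z) c))"
      using sum[OF y(1)] .
    also have "(\<Sum>c<2 ^ k. g (xor (syndrome b 0 z) c)) = (\<Sum>c<2 ^ k. g c)"
      by (intro sum_xor_shift syn zuv)
    also have "xor (syndrome b 0 z) (G ?y) = G' x"
      using zuv by (simp add: x G')
    finally have sum_y: "(\<Sum>i<n. g (xor (syndrome b 0 z) (G (nbr a b ?y i)))) =
        (real n - real e * 2 ^ k) * g (G' x) + real e * (\<Sum>c<2 ^ k. g c)" .
    have sum_uv: "(\<Sum>i<n. g (G' (nbr a b x (?s + i)))) + (\<Sum>i<n. g (G' (nbr a b x (?s + (n + i))))) =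
        (\<Sum>i<n. g (xor (syndrome b 0 z) (G (nbr a b ?y i)))) + real n * g (G' x)"
      using zuv by (simp add: x nbr_u nbr_v G')
    have "(\<Sum>i<?s + (n + n). g (G' (nbr a b x i))) = (\<Sum>c<2 ^ k. g c) +
        ((real n - real e * 2 ^ k) * g (G' x) + real e * (\<Sum>c<2 ^ k. g c) + real n * g (G' x))"
      by (simp only: sum_lessThan_add sum_z sum_uv sum_y)
    then show ?thesis
      by (simp add: algebra_simps)
  qed
  moreover have "\<exists>h. h \<noteq> 0 \<and> (\<forall>c<2 ^ k. \<exists>x\<in>?W (?s + (n + n)). G' x = c \<and> G' (nbr a b x i) = xor h c)"
    if i: "i < ?s + (n + n)" for i
  proof -
    consider "i < ?s" | j where "j < n" "i = ?s + j" | j where "j < n" "i = ?s + (n + j)"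
      using i by (metis add_less_cancel_left less_diff_conv2 linorder_not_less le_Suc_ex)
    then show ?thesis
    proof cases
      case 1
      \<comment> \<open>Here the flip exchanges the roles of \<open>u\<close> and \<open>v\<close>,
        whose colours can be prescribed independently, so the total shift can be made 1; this is a
        colour because \<open>k > 0\<close>. The term \<open>xor i\<close> in the colour of
        \<open>v\<close> cancels the column that the flip adds.\<close>
      have "\<exists>x\<in>?W (?s + (n + n)). G' x = c \<and> G' (nbr a b x i) = xor 1 c" if c: "c < 2 ^ k" for c
      proof -
        have "xor i (xor 1 c) < 2 ^ k"
          using 1 c one_less_power[OF _ k, of "2 :: nat"] by (intro xor_nat_less_exp) auto
        then obtain u v where uv: "u \<in> ?W n" "G u = c" "v \<in> ?W n" "G v = xor i (xor 1 c)"
          using onto c by metis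
        then have "G' (nbr a b (z0 @ u @ v) i) = xor 1 c"
          using z0 1 by (simp add: nbr_z xor_xor_cancel)
        moreover have "G' (z0 @ u @ v) = c"
          using z0 uv by (simp add: G')
        ultimately show ?thesis
          using mem z0(1) uv by blast
      qed
      then show ?thesis
        by (intro exI[of _ 1]) simp
    next
      case (2 j)
      obtain h where h: "h \<noteq> 0" "\<And>c. c < 2 ^ k \<Longrightarrow> \<exists>x\<in>?W n. G x = c \<and> G (nbr a b x j) = xor h c"
        using dep[OF 2(1)] by blast
      have "\<exists>x\<in>?W (?s + (n + n)). G' x = c \<and> G' (nbr a b x i) = xor h c" if c: "c < 2 ^ k" for c
      proof -
        obtain u where "u \<in> ?W n" "G u = c" "G (nbr a b u j) = xor h c"
          using h(2)[OF c] by blast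
        then show ?thesis
          using z0 w 2 by (intro bexI[of _ "z0 @ u @ w"]) (simp_all add: nbr_u G' mem)
      qed
      then show ?thesis
        using h(1) by blast
    next
      case (3 j)
      obtain h where h: "h \<noteq> 0" "\<And>c. c < 2 ^ k \<Longrightarrow> \<exists>x\<in>?W n. G x = c \<and> G (nbr a b x j) = xor h c"
        using dep[OF 3(1)] by blast
      have "\<exists>x\<in>?W (?s + (n + n)). G' x = c \<and> G' (nbr a b x i) = xor h c" if c: "c < 2 ^ k" for c
      proof -
        obtain v where "v \<in> ?W n" "G v = c" "G (nbr a b v j) = xor h c"
          using h(2)[OF c] by blast
        then show ?thesis
          using z1 w 3 by (intro bexI[of _ "z1 @ w @ v"]) (simp_all add: nbr_v G' mem)
      qed
      then show ?thesis
        using h(1) by blast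
    qed
  qed
  ultimately show ?thesis
    unfolding equitable_def by blast
qed

text \<open>The formula for the dimension obeys the recurrence of \<open>equitable_step\<close>; the
  inequality in the proof shows that the subtraction on \<open>nat\<close> is not truncated.\<close>

lemma dimension_step:
  "(2 * s - 1) * 2 ^ Suc m - s = s + (((2 * s - 1) * 2 ^ m - s) + ((2 * s - 1) * 2 ^ m - s))"
  if "s > 0" for s m :: nat
proof -
  have "s * 1 \<le> (2 * s - 1) * 2 ^ m"
    using that by (intro mult_le_mono) auto
  then show ?thesis
    by simp
qed

lemma equitable_exists:
  assumes "a \<noteq> b" "k > 0"
  shows "\<exists>G. equitable a b k ((2 * 2 ^ k - 1) * 2 ^ m - 2 ^ k) (Suc m) G"
proof (induction m)
  case 0
  have "(2 * 2 ^ k - 1) * 2 ^ 0 - 2 ^ k = (2 ^ k - 1 :: nat)"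
    by simp
  then show ?case
    using equitable_syndrome[OF assms(1), of k] by auto
next
  case (Suc m)
  then show ?case
    using equitable_step[OF assms] by (subst dimension_step) auto
qed

text \<open>This places the index \<open>e * s / 2\<close> among the eigenspaces
  \<open>0, ..., n\<close>. In each step the left side grows by \<open>s\<close>, while the right
  side doubles and gains \<open>2 * s\<close>.\<close>

lemma degree_le_dimension:
  "Suc m * s \<le> 2 * ((2 * s - 1) * 2 ^ m - s)" if "s \<ge> 2" for s m :: nat
proof (induction m)
  case (Suc m)
  then show ?case
    using that by (subst dimension_step) auto
qed (use that in simp)

section \<open>Boolean functions with a single nonconstant eigencomponent\<close>

lemma fun_degree_two_eigenspaces:
  assumes A: "card A = 2" and d: "0 < d" "d \<le> n"
    and eig: "\<And>x. x \<in> words A n \<Longrightarrow>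
      (\<Sum>y\<in>hamming_nbrs A n x. f y - \<rho>) = (real n - 2 * real d) * (f x - \<rho>)"
    and nonconst: "x0 \<in> words A n" "f x0 \<noteq> \<rho>"
  shows "fun_degree A n f = d" and "(\<Sum>x\<in>words A n. f x) = \<rho> * real (card (words A n))"
proof -
  obtain a b where ab: "A = {a, b}" "a \<noteq> b"
    using A by (auto simp: card_2_iff)
  \<comment> \<open>The two components are extended by 0 because members of
    \<open>eigenspace\<close> vanish outside \<open>words A n\<close>.\<close>
  define u where "u x = (if x \<in> words A n then \<rho> else 0)" for x
  define v where "v x = (if x \<in> words A n then f x - \<rho> else 0)" for x
  define g where "g i = (if i = 0 then u else if i = d then v else (\<lambda>_. 0))" for i
  have const: "(\<lambda>x. if x \<in> words A n then c else 0) \<in> eigenspace A n 0" for c :: real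
  proof -
    have "(\<Sum>y\<in>hamming_nbrs A n x. if y \<in> words A n then c else 0) = real n * c"
      if "x \<in> words A n" for x
      using that ab by (simp add: sum_hamming_nbrs nbr_in_words)
    then show ?thesis
      by (simp add: eigenspace_def)
  qed
  have "(\<Sum>y\<in>hamming_nbrs A n x. v y) = (\<Sum>y\<in>hamming_nbrs A n x. f y - \<rho>)" for x
    by (intro sum.cong) (auto simp: v_def hamming_nbrs_def)
  then have v: "v \<in> eigenspace A n d"
    using eig by (simp add: eigenspace_def v_def)
  have "(\<Sum>i\<le>n. g i x) = u x + v x" for x
  proof -
    have "(\<Sum>i\<le>n. g i x) = (\<Sum>i\<in>{0, d}. g i x)"
      using d by (intro sum.mono_neutral_right) (auto simp: g_def)
    then show ?thesis
      using d by (simp add: g_def)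
  qed
  moreover have "u \<in> eigenspace A n 0"
    using const[of \<rho>] by (simp add: u_def[abs_def])
  moreover have "(\<lambda>_. 0) \<in> eigenspace A n i" for i
    by (simp add: eigenspace_def)
  ultimately have g: "eigendecomposition A n f g"
    using v d by (auto simp: eigendecomposition_def g_def u_def v_def)
  \<comment> \<open>Uniqueness of the decomposition identifies the explicit components with the
    projections.\<close>
  have proj: "eigenprojection A n i f = g i" for i
    using eigendecomposition_ex1[OF A, of n f] g by (metis eigenprojection_def the1_equality)
  have "v \<noteq> (\<lambda>_. 0)"
    using nonconst by (auto simp: v_def fun_eq_iff)
  then have "d \<in> {i. i \<le> n \<and> eigenprojection A n i f \<noteq> (\<lambda>_. 0)}"
    using d by (simp add: proj g_def)
  moreover have "{i. i \<le> n \<and> eigenprojection A n i f \<noteq> (\<lambda>_. 0)} \<subseteq> {0, d}"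
    by (auto simp: proj g_def)
  ultimately have "insert 0 {i. i \<le> n \<and> eigenprojection A n i f \<noteq> (\<lambda>_. 0)} = {0, d}"
    by blast
  then show "fun_degree A n f = d"
    by (simp add: fun_degree_def)
  have "finite A"
    using ab by simp
  from eigenspace_orthogonal[OF this v const[of 1]] d
  have "(\<Sum>x\<in>words A n. f x - \<rho>) = 0"
    by (simp add: v_def)
  then show "(\<Sum>x\<in>words A n. f x) = \<rho> * real (card (words A n))"
    by (simp add: sum_subtractf)
qed

section \<open>The indicator of an odd initial segment of colours\<close>

theorem corollary3:
  fixes A :: "'a set" and \<rho> :: real and r :: int and s k e n :: nat
  assumes "card A = 2"
    and "s = 2 ^ k" and "odd r" and "0 < r" and "r < int s"
    and "\<rho> = real_of_int r / real s"
    and "e > 0"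
    and "n = (2 * s - 1) * 2 ^ (e - 1) - s"
  shows "\<exists>f :: 'a list \<Rightarrow> real.
           boolean_fun A n f \<and>
           (\<forall>i<n. depends_on A n f i) \<and>
           real (fun_degree A n f) = real e * real s / 2 \<and>
           density_of_ones A n f = \<rho>"
proof -
  obtain a b where A: "A = {a, b}" and ab: "a \<noteq> b"
    using assms(1) by (auto simp: card_2_iff)
  \<comment> \<open>For \<open>k = 0\<close> there would be no integer strictly between 0 and
    \<open>s = 1\<close>.\<close>
  have "k \<noteq> 0"
    using assms(2,4,5) by (intro notI) simp
  then have k: "k > 0" by simp
  then have s: "even s" "s \<ge> 2"
    using assms(2) self_le_power[of 2 k] by auto
  define t where "t = nat r"
  have t: "odd t" "t < s" "real t = real_of_int r"
    using assms(3,4,5) by (auto simp: t_def even_nat_iff)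
  have \<rho>: "\<rho> * real s = real t" "0 < \<rho>" "\<rho> < 1"
  proof -
    have "0 < real_of_int r" "real_of_int r < real s"
      using assms(4,5) by linarith+
    then show "\<rho> * real s = real t" "0 < \<rho>" "\<rho> < 1"
      using assms(6) t(3) by auto
  qed
  obtain m where m: "e = Suc m"
    using assms(7) by (cases e) auto
  obtain G where G: "equitable a b k n e G"
    using equitable_exists[OF ab k, of m] assms(2,8) m by auto
  define f where "f x = (if G x < t then 1 else 0 :: real)" for x
  define d where "d = e * s div 2"
  have d2: "2 * real d = real e * real s"
    using s(1) unfolding d_def by (metis dvd_mult dvd_mult_div_cancel of_nat_mult of_nat_numeral)
  have "2 * d \<le> 2 * n"
    using degree_le_dimension[OF s(2), of m] assms(8) m by (simp add: d_def)
  then have d: "0 < d" "d \<le> n"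
    using assms(7) s by (auto simp: d_def div_greater_zero_iff intro: order_trans[of _ "1 * s"])
  have eig: "(\<Sum>y\<in>hamming_nbrs A n x. f y - \<rho>) = (real n - 2 * real d) * (f x - \<rho>)"
    if x: "x \<in> words A n" for x
  proof -
    define g where "g c = (if c < t then 1 else 0) - \<rho>" for c
    have "(\<Sum>c<2 ^ k. if c < t then 1 else 0 :: real) = (\<Sum>c<t. 1)"
      using t(2) assms(2) by (intro sum.mono_neutral_cong_right) auto
    \<comment> \<open>The sum is \<open>t - \<rho> * s\<close>. Its vanishing leaves only the
      eigenvalue term \<open>n - e * s = n - 2 * d\<close> in the third condition of
      \<open>equitable\<close>.\<close>
    then have "(\<Sum>c<2 ^ k. g c) = 0"
      using \<rho> assms(2) by (simp add: g_def sum_subtractf mult.commute)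
    moreover have "(\<Sum>i<n. g (G (nbr a b x i))) =
        (real n - real e * 2 ^ k) * g (G x) + real e * (\<Sum>c<2 ^ k. g c)"
      using G x unfolding equitable_def A by blast
    ultimately have "(\<Sum>i<n. f (nbr a b x i) - \<rho>) = (real n - 2 * real d) * (f x - \<rho>)"
      using d2 assms(2) by (simp add: f_def g_def)
    then show ?thesis
      using sum_hamming_nbrs[OF ab, of x n "\<lambda>y. f y - \<rho>"] x by (simp add: A)
  qed
  have dep: "depends_on A n f i" if i: "i < n" for i
  proof -
    obtain h where h: "h \<noteq> 0"
      "\<And>c. c < 2 ^ k \<Longrightarrow> \<exists>x\<in>words {a, b} n. G x = c \<and> G (nbr a b x i) = xor h c"
      using G i unfolding equitable_def by blast
    \<comment> \<open>A colour inside the segment that the shift \<open>h\<close> at position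
      \<open>i\<close> carries out of it; a word of this colour and its neighbour witness the
      dependence.\<close>
    obtain c where c: "c < t" "\<not> xor h c < t"
      using xor_moves_odd_interval[OF t(1) h(1)] .
    obtain x where x: "x \<in> words {a, b} n" "G x = c" "G (nbr a b x i) = xor h c"
      using h(2)[of c] c t(2) assms(2) by auto
    have "f x \<noteq> f (nbr a b x i)"
      using x c by (simp add: f_def)
    then show ?thesis
      unfolding depends_on_def A
      using x(1) nbr_in_words[OF ab x(1) i] nbr_differs[OF ab x(1) i] by blast
  qed
  have x0: "replicate n a \<in> words A n"
    by (simp add: A replicate_in_words)
  \<comment> \<open>As \<open>f\<close> takes only the values 0 and 1 and \<open>\<rho>\<close> lies
    strictly between them, any word would do.\<close>
  have "f (replicate n a) \<noteq> \<rho>"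
    using \<rho> by (simp add: f_def)
  note deg = fun_degree_two_eigenspaces[OF assms(1) d eig x0 this]
  have "finite (words A n)"
    by (simp add: A finite_words)
  then have "real (card {x \<in> words A n. f x = 1}) = (\<Sum>x\<in>words A n. f x)"
    by (simp add: f_def sum.If_cases Collect_conj_eq)
  moreover have "card (words A n) \<noteq> 0"
    using \<open>finite (words A n)\<close> x0 by auto
  ultimately have "density_of_ones A n f = \<rho>"
    using deg(2) by (simp add: density_of_ones_def)
  moreover have "boolean_fun A n f"
    by (simp add: boolean_fun_def f_def)
  ultimately show ?thesis
    using dep deg(1) d2 by (intro exI[of _ f]) simp
qed

end
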